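(* The logic $\mathbf{IL}\mathsf{M}$ is modally complete: for every formula $\varphi$ of the language of interpretability logic, if $M,w\Vdash\varphi$ for every $\mathbf{IL}$-model $M=\langle W,R,S,\Vdash\rangle$ whose underlying frame $\langle W,R,S\rangle$ is an $\mathbf{IL}\mathsf{M}$-frame and every $w\in W$, then $\mathbf{IL}\mathsf{M}\vdash\varphi$.
   Context: Formulas are built from $\bot$ and a countable set $\mathsf{Prop}$ of propositional variables using the binary connective $\rightarrow$, the unary modality $\Box$ and the binary modality $\rhd$; $\neg,\wedge,\vee,\leftrightarrow,\top$ are defined as usual and $\Diamond A:=\neg\Box\neg A$. Here $\rhd$ binds more weakly than $\neg,\Box,\Diamond,\wedge,\vee$ and more strongly than $\rightarrow$. The logic $\mathbf{IL}$ is the smallest set of formulas closed under Necessitation and Modus Ponens that contains all propositional tautologies and all instances of: L1 $\Box(A\rightarrow B)\rightarrow(\Box A\rightarrow\Box B)$; L2 $\Box A\rightarrow\Box\Box A$; L3 $\Box(\Box A\rightarrow A)\rightarrow\Box A$; J1 $\Box(A\rightarrow B)\rightarrow A\rhd B$; J2 $(A\rhd B)\wedge(B\rhd C)\rightarrow A\rhd C$; J3 $(A\rhd C)\wedge(B\rhd C)\rightarrow A\vee B\rhd C$; J4 $A\rhd B\rightarrow(\Diamond A\rightarrow\Diamond B)$; J5 $\Diamond A\rhd A$. $\mathbf{IL}\mathsf{M}$ is obtained by adding the axiom schema M: $A\rhd B\rightarrow A\wedge\Box C\rhd B\wedge\Box C$. $\mathbf{IL}\mathsf{M}\vdash\varphi$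 means $\varphi\in\mathbf{IL}\mathsf{M}$. An $\mathbf{IL}$-frame is a triple $\langle W,R,S\rangle$ with $W$ a non-empty countable set, $R$ a binary relation on $W$, and $S=\{S_x\mid x\in W\}$ a set of binary relations on $W$ indexed by $W$, such that: (1) $R$ is conversely well-founded (every non-empty subset of $W$ has an $R$-maximal element); (2) $xRy$ and $yRz$ imply $xRz$; (3) $yS_xz$ implies $xRy$ and $xRz$; (4) $xRy$ implies $yS_xy$; (5) $xRyRz$ implies $yS_xz$; (6) $uS_xvS_xw$ implies $uS_xw$. An $\mathbf{IL}\mathsf{M}$-frame is an $\mathbf{IL}$-frame on which $yS_xzRu$ implies $yRu$ for all $x,y,z,u$. An $\mathbf{IL}$-model is $\langle W,R,S,\Vdash\rangle$ with $\langle W,R,S\rangle$ an $\mathbf{IL}$-frame and $\Vdash\subseteq W\times\mathsf{Prop}$, extended to all formulas by the usual Boolean clauses and: $w\Vdash\Box A$ iff $v\Vdash A$ for all $v$ with $wRv$; $w\Vdash A\rhd B$ iff for every $u$ with $wRu$ and $u\Vdash A$ there is $v$ with $uS_wv$ and $v\Vdash B$. *)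

theory Defs
  imports "HOL-Library.Countable_Set"
begin

text \<open>
  Formulas of interpretability logic. The type variable stands for the set of propositional
  variables; it is required to be countable only where this is needed. The connectives are printed
  in bold to keep them apart from those of the metalanguage.
\<close>

datatype 'p fm =
    Bot ("\<^bold>\<bottom>")
  | Var 'p
  | Imp "'p fm" "'p fm" (infixr "\<^bold>\<rightarrow>" 55)
  | Box "'p fm" ("\<^bold>\<box> _" [75] 75)
  | Rhd "'p fm" "'p fm" (infix "\<^bold>\<rhd>" 58)

abbreviation Neg :: "'p fm \<Rightarrow> 'p fm" ("\<^bold>\<not> _" [75] 75) where
  "\<^bold>\<not> A \<equiv> A \<^bold>\<rightarrow> \<^bold>\<bottom>"

abbreviation Or :: "'p fm \<Rightarrow> 'p fm \<Rightarrow> 'p fm" (infixr "\<^bold>\<or>" 62) where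
  "A \<^bold>\<or> B \<equiv> \<^bold>\<not> A \<^bold>\<rightarrow> B"

abbreviation And :: "'p fm \<Rightarrow> 'p fm \<Rightarrow> 'p fm" (infixr "\<^bold>\<and>" 65) where
  "A \<^bold>\<and> B \<equiv> \<^bold>\<not> (A \<^bold>\<rightarrow> \<^bold>\<not> B)"

abbreviation Dia :: "'p fm \<Rightarrow> 'p fm" ("\<^bold>\<diamond> _" [75] 75) where
  "\<^bold>\<diamond> A \<equiv> \<^bold>\<not> \<^bold>\<box> \<^bold>\<not> A"

text \<open>
  A propositional tautology is a formula of the full modal language that is true under every
  two-valued assignment treating variables, \<open>\<^bold>\<box>\<close>-formulas and \<open>\<^bold>\<rhd>\<close>-formulas as atoms.
\<close>

primrec bool_eval :: "('p fm \<Rightarrow> bool) \<Rightarrow> 'p fm \<Rightarrow> bool" where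
  "bool_eval v \<^bold>\<bottom> \<longleftrightarrow> False"
| "bool_eval v (Var p) \<longleftrightarrow> v (Var p)"
| "bool_eval v (A \<^bold>\<rightarrow> B) \<longleftrightarrow> (bool_eval v A \<longrightarrow> bool_eval v B)"
| "bool_eval v (\<^bold>\<box> A) \<longleftrightarrow> v (\<^bold>\<box> A)"
| "bool_eval v (A \<^bold>\<rhd> B) \<longleftrightarrow> v (A \<^bold>\<rhd> B)"

definition tautology :: "'p fm \<Rightarrow> bool" where
  "tautology A \<longleftrightarrow> (\<forall>v. bool_eval v A)"

text \<open>
  The extension of \<open>IL\<close> by a set \<open>X\<close> of additional axioms, given as all instances of the added
  schemata.
\<close>

inductive_set IL_with :: "'p fm set \<Rightarrow> 'p fm set" for X :: "'p fm set" where
  Ax: "A \<in> X \<Longrightarrow> A \<in> IL_with X"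
| Taut: "tautology A \<Longrightarrow> A \<in> IL_with X"
| L1: "\<^bold>\<box> (A \<^bold>\<rightarrow> B) \<^bold>\<rightarrow> (\<^bold>\<box> A \<^bold>\<rightarrow> \<^bold>\<box> B) \<in> IL_with X"
| L2: "\<^bold>\<box> A \<^bold>\<rightarrow> \<^bold>\<box> \<^bold>\<box> A \<in> IL_with X"
| L3: "\<^bold>\<box> (\<^bold>\<box> A \<^bold>\<rightarrow> A) \<^bold>\<rightarrow> \<^bold>\<box> A \<in> IL_with X"
| J1: "\<^bold>\<box> (A \<^bold>\<rightarrow> B) \<^bold>\<rightarrow> A \<^bold>\<rhd> B \<in> IL_with X"
| J2: "(A \<^bold>\<rhd> B) \<^bold>\<and> (B \<^bold>\<rhd> C) \<^bold>\<rightarrow> A \<^bold>\<rhd> C \<in> IL_with X"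
| J3: "(A \<^bold>\<rhd> C) \<^bold>\<and> (B \<^bold>\<rhd> C) \<^bold>\<rightarrow> A \<^bold>\<or> B \<^bold>\<rhd> C \<in> IL_with X"
| J4: "A \<^bold>\<rhd> B \<^bold>\<rightarrow> (\<^bold>\<diamond> A \<^bold>\<rightarrow> \<^bold>\<diamond> B) \<in> IL_with X"
| J5: "\<^bold>\<diamond> A \<^bold>\<rhd> A \<in> IL_with X"
| Nec: "A \<in> IL_with X \<Longrightarrow> \<^bold>\<box> A \<in> IL_with X"
| MP: "A \<^bold>\<rightarrow> B \<in> IL_with X \<Longrightarrow> A \<in> IL_with X \<Longrightarrow> B \<in> IL_with X"

definition IL :: "'p fm set" where
  "IL = IL_with {}"

definition ILM :: "'p fm set" where
  "ILM = IL_with {A \<^bold>\<rhd> B \<^bold>\<rightarrow> A \<^bold>\<and> \<^bold>\<box> C \<^bold>\<rhd> B \<^bold>\<and> \<^bold>\<box> C | A B C. True}"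

text \<open>
  The indexed family of relations is a total function \<open>S\<close> on the ambient type; its values outside
  \<open>W\<close> are arbitrary and play no role. Since \<open>W\<close> is countable, every frame is isomorphic to one whose
  worlds are natural numbers; hence validity in all frames of a class can be expressed with worlds
  of type \<^typ>\<open>nat\<close>.
\<close>

locale IL_frame =
  fixes W :: "'w set"
    and R :: "'w rel"
    and S :: "'w \<Rightarrow> 'w rel"
  assumes nonempty: "W \<noteq> {}"
    and countable: "countable W"
    and R_on: "R \<subseteq> W \<times> W"
    and S_on: "x \<in> W \<Longrightarrow> S x \<subseteq> W \<times> W"
    and conv_wf: "X \<subseteq> W \<Longrightarrow> X \<noteq> {} \<Longrightarrow> \<exists>m\<in>X. \<forall>y\<in>X. (m, y) \<notin> R"
    and R_trans: "(x, y) \<in> R \<Longrightarrow> (y, z) \<in> R \<Longrightarrow> (x, z) \<in> R"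
    and S_above: "x \<in> W \<Longrightarrow> (y, z) \<in> S x \<Longrightarrow> (x, y) \<in> R \<and> (x, z) \<in> R"
    and S_refl: "(x, y) \<in> R \<Longrightarrow> (y, y) \<in> S x"
    and R_in_S: "(x, y) \<in> R \<Longrightarrow> (y, z) \<in> R \<Longrightarrow> (y, z) \<in> S x"
    and S_trans: "x \<in> W \<Longrightarrow> (u, v) \<in> S x \<Longrightarrow> (v, w) \<in> S x \<Longrightarrow> (u, w) \<in> S x"

locale ILM_frame = IL_frame +
  assumes M_cond: "x \<in> W \<Longrightarrow> (y, z) \<in> S x \<Longrightarrow> (z, u) \<in> R \<Longrightarrow> (y, u) \<in> R"

locale IL_model = IL_frame W R S
  for W :: "'w set" and R :: "'w rel" and S :: "'w \<Rightarrow> 'w rel" +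
  fixes V :: "('w \<times> 'p) set"
  assumes V_on: "V \<subseteq> W \<times> UNIV"

text \<open>
  In a model all relations stay inside \<open>W\<close>, so the quantifiers over worlds below need no explicit
  restriction to \<open>W\<close>.
\<close>

primrec forces ::
  "'w rel \<Rightarrow> ('w \<Rightarrow> 'w rel) \<Rightarrow> ('w \<times> 'p) set \<Rightarrow> 'w \<Rightarrow> 'p fm \<Rightarrow> bool" where
  "forces R S V w \<^bold>\<bottom> \<longleftrightarrow> False"
| "forces R S V w (Var p) \<longleftrightarrow> (w, p) \<in> V"
| "forces R S V w (A \<^bold>\<rightarrow> B) \<longleftrightarrow> (forces R S V w A \<longrightarrow> forces R S V w B)"
| "forces R S V w (\<^bold>\<box> A) \<longleftrightarrow> (\<forall>v. (w, v) \<in> R \<longrightarrow> forces R S V v A)"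
| "forces R S V w (A \<^bold>\<rhd> B) \<longleftrightarrow>
    (\<forall>u. (w, u) \<in> R \<and> forces R S V u A \<longrightarrow> (\<exists>v. (u, v) \<in> S w \<and> forces R S V v B))"

end

theory Submission
  imports Defs
begin

text \<open>
  An unprovable \<open>\<phi>\<close> lies outside some maximal consistent set \<open>\<Gamma>\<close>; a countable model is built in which
  some world refutes exactly the formulas outside \<open>\<Gamma>\<close> that matter for \<open>\<phi>\<close>.

  The modal content is one existence lemma, \<open>critical_successor_exists\<close>. Call \<open>\<Delta>\<close> a \<open>C\<close>-critical
  successor of \<open>\<Gamma>\<close> if it contains \<open>\<^bold>\<not> E\<close> and \<open>\<^bold>\<box> \<^bold>\<not> E\<close> whenever \<open>E \<^bold>\<rhd> C \<in> \<Gamma>\<close>. If \<open>A \<^bold>\<rhd> C \<notin> \<Gamma>\<close>, there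
  is a \<open>C\<close>-critical successor containing \<open>A\<close>. If \<open>A \<^bold>\<rhd> B \<in> \<Gamma>\<close> and \<open>\<Theta>\<close> is a \<open>C\<close>-critical successor
  containing \<open>A\<close>, there is another one that contains \<open>B\<close> and, by axiom M, all \<open>\<^bold>\<box>\<close>-formulas of \<open>\<Theta>\<close>.

  The worlds form a tree with two kinds of edges, one for each of these two situations. A branch
  from \<open>y\<close> makes a new world that refutes \<open>A \<^bold>\<rhd> C\<close> at \<open>y\<close>; its \<open>R\<close>-parent is \<open>y\<close>. A switch from
  \<open>y\<close> over an earlier world \<open>v\<close> below \<open>y\<close> makes a new world that supplies the \<open>B\<close> demanded by
  \<open>A \<^bold>\<rhd> B\<close> at \<open>v\<close> when \<open>A\<close> holds at \<open>y\<close>; its \<open>R\<close>-parent is \<open>v\<close>. Now let \<open>x R z\<close> hold iff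
  \<open>x\<close> lies on the path from the root to the \<open>R\<close>-parent of \<open>z\<close>, and let \<open>y S\<^sub>x z\<close> hold iff \<open>x R y\<close>,
  \<open>x R z\<close> and \<open>y\<close> lies on the path to \<open>z\<close>. All frame conditions, including the one for M, then
  follow from transitivity of the tree order. The relation \<open>S\<^sub>x\<close> is as large as the tree order allows,
  so what needs care is that a branch made at \<open>x\<close> to refute \<open>A \<^bold>\<rhd> C\<close> sees no world satisfying \<open>C\<close>:
  every world above \<open>x\<close> in that branch must have a \<open>C\<close>-critical label. This is the invariant \<open>good\<close>.

  Every \<open>R\<close>-step adds a formula \<open>\<^bold>\<box> \<^bold>\<not> A\<close> with \<open>A\<close> taken from a finite set depending on \<open>\<phi>\<close>, which
  makes \<open>R\<close> conversely well-founded although the tree may have infinite paths. The labels are chosen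
  once for each world, so worlds are finite terms over a countable language, there are countably many
  of them, and they can be renamed to natural numbers.
\<close>

section \<open>Maximal consistent sets\<close>

definition closed_theory :: "'p fm set \<Rightarrow> bool" where
  "closed_theory T \<longleftrightarrow> ILM \<subseteq> T \<and> (\<forall>A B. A \<^bold>\<rightarrow> B \<in> T \<longrightarrow> A \<in> T \<longrightarrow> B \<in> T)"

definition mcs :: "'p fm set \<Rightarrow> bool" where
  "mcs T \<longleftrightarrow> closed_theory T \<and> \<^bold>\<bottom> \<notin> T \<and> (\<forall>A. A \<in> T \<or> \<^bold>\<not> A \<in> T)"

text \<open>
  Below, these rules are referred to by position: the added axiom, tautologies, L1 to L3, J1 to J5.
\<close>

lemmas ILM_intros = IL_with.intros[where X = "{A \<^bold>\<rhd> B \<^bold>\<rightarrow> A \<^bold>\<and> \<^bold>\<box> C \<^bold>\<rhd> B \<^bold>\<and> \<^bold>\<box> C | A B C. True}",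
    folded ILM_def]

lemma closed_theory_ILM: "closed_theory T \<Longrightarrow> A \<in> ILM \<Longrightarrow> A \<in> T"
  by (auto simp: closed_theory_def)

lemma closed_theory_MP: "closed_theory T \<Longrightarrow> A \<^bold>\<rightarrow> B \<in> T \<Longrightarrow> A \<in> T \<Longrightarrow> B \<in> T"
  by (auto simp: closed_theory_def)

lemma tautology_in_ILM: "tautology A \<Longrightarrow> A \<in> ILM"
  by (rule ILM_intros)

lemma closed_theory_tautology: "closed_theory T \<Longrightarrow> tautology A \<Longrightarrow> A \<in> T"
  by (blast intro: closed_theory_ILM tautology_in_ILM)

lemma closed_theory_ILM_self: "closed_theory ILM"
  unfolding closed_theory_def ILM_def by (blast intro: IL_with.MP)

text \<open>
  The deduction theorem in disguise: the theory generated by \<open>T\<close> and \<open>A\<close> consists of the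
  \<open>B\<close> with \<open>A \<^bold>\<rightarrow> B \<in> T\<close>, so no notion of derivation from premises is needed.
\<close>

lemma closed_theory_adjoin:
  assumes "closed_theory T"
  shows "closed_theory {B. A \<^bold>\<rightarrow> B \<in> T}"
  unfolding closed_theory_def
proof (intro conjI subsetI allI impI)
  fix B :: "'a fm"
  assume "B \<in> ILM"
  moreover have "B \<^bold>\<rightarrow> A \<^bold>\<rightarrow> B \<in> T"
    by (rule closed_theory_tautology[OF assms]) (simp add: tautology_def)
  ultimately show "B \<in> {B. A \<^bold>\<rightarrow> B \<in> T}"
    using assms closed_theory_ILM closed_theory_MP by blast
next
  fix B C
  assume "B \<^bold>\<rightarrow> C \<in> {B. A \<^bold>\<rightarrow> B \<in> T}" "B \<in> {B. A \<^bold>\<rightarrow> B \<in> T}"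
  moreover have "(A \<^bold>\<rightarrow> B \<^bold>\<rightarrow> C) \<^bold>\<rightarrow> (A \<^bold>\<rightarrow> B) \<^bold>\<rightarrow> A \<^bold>\<rightarrow> C \<in> T"
    by (rule closed_theory_tautology[OF assms]) (simp add: tautology_def)
  ultimately show "C \<in> {B. A \<^bold>\<rightarrow> B \<in> T}"
    using assms closed_theory_MP by blast
qed

lemma closed_theory_Union_chain:
  assumes "\<C> \<noteq> {}" "subset.chain {T. closed_theory T} \<C>"
  shows "closed_theory (\<Union>\<C>)"
  unfolding closed_theory_def
proof (intro conjI allI impI)
  obtain T where "T \<in> \<C>" "closed_theory T"
    using assms by (auto simp: subset.chain_def)
  then show "ILM \<subseteq> \<Union>\<C>"
    using closed_theory_ILM by blast
next
  fix A B
  assume "A \<^bold>\<rightarrow> B \<in> \<Union>\<C>" "A \<in> \<Union>\<C>"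
  then obtain T T' where "T \<in> \<C>" "T' \<in> \<C>" "A \<^bold>\<rightarrow> B \<in> T" "A \<in> T'"
    by blast
  moreover from this have "T \<subseteq> T' \<or> T' \<subseteq> T" "closed_theory T" "closed_theory T'"
    using assms(2) by (auto simp: subset.chain_def)
  ultimately show "B \<in> \<Union>\<C>"
    using closed_theory_MP by blast
qed

lemma Lindenbaum:
  assumes T: "closed_theory T" "\<^bold>\<bottom> \<notin> T"
  obtains M where "mcs M" "T \<subseteq> M"
proof -
  let ?\<A> = "{M. closed_theory M \<and> \<^bold>\<bottom> \<notin> M \<and> T \<subseteq> M}"
  have "\<exists>M\<in>?\<A>. \<forall>X\<in>?\<A>. M \<subseteq> X \<longrightarrow> X = M"
  proof (rule subset_Zorn_nonempty)
    show "?\<A> \<noteq> {}"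
      using T by blast
  next
    fix \<C>
    assume \<C>: "\<C> \<noteq> {}" "subset.chain ?\<A> \<C>"
    then have sub: "\<C> \<subseteq> ?\<A>"
      by (simp add: subset.chain_def)
    have "closed_theory (\<Union>\<C>)"
      using \<C> by (intro closed_theory_Union_chain) (auto simp: subset.chain_def)
    moreover have "T \<subseteq> \<Union>\<C>"
      using sub \<C>(1) by fast
    moreover have "\<^bold>\<bottom> \<notin> \<Union>\<C>"
      using sub by fast
    ultimately show "\<Union>\<C> \<in> ?\<A>"
      by simp
  qed
  then obtain M where "M \<in> ?\<A>" and M_max: "\<forall>X\<in>?\<A>. M \<subseteq> X \<longrightarrow> X = M"
    by (elim bexE)
  then have M: "closed_theory M" "\<^bold>\<bottom> \<notin> M" "T \<subseteq> M"
    by simp_all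
  have "\<^bold>\<not> A \<in> M" if "A \<notin> M" for A
  proof (rule ccontr)
    assume "\<^bold>\<not> A \<notin> M"
    let ?X = "{B. A \<^bold>\<rightarrow> B \<in> M}"
    have "M \<subseteq> ?X"
    proof
      fix B assume "B \<in> M"
      moreover have "B \<^bold>\<rightarrow> A \<^bold>\<rightarrow> B \<in> M"
        by (rule closed_theory_tautology[OF M(1)]) (simp add: tautology_def)
      ultimately show "B \<in> ?X"
        using M(1) closed_theory_MP by blast
    qed
    moreover have "A \<in> ?X"
      using closed_theory_tautology[OF M(1), of "A \<^bold>\<rightarrow> A"] by (simp add: tautology_def)
    moreover have "?X = M"
      using M_max \<open>\<^bold>\<not> A \<notin> M\<close> M(3) \<open>M \<subseteq> ?X\<close> closed_theory_adjoin[OF M(1)] by simp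
    ultimately show False
      using that by blast
  qed
  then have "mcs M"
    using M by (auto simp: mcs_def)
  then show thesis
    using M(3) that by blast
qed

lemma mcs_ILM: "mcs T \<Longrightarrow> A \<in> ILM \<Longrightarrow> A \<in> T"
  by (auto simp: mcs_def closed_theory_ILM)

lemma mcs_Bot: "mcs T \<Longrightarrow> \<^bold>\<bottom> \<notin> T"
  by (auto simp: mcs_def)

lemma mcs_Imp: "mcs T \<Longrightarrow> A \<^bold>\<rightarrow> B \<in> T \<longleftrightarrow> (A \<in> T \<longrightarrow> B \<in> T)"
proof
  assume T: "mcs T" and imp: "A \<in> T \<longrightarrow> B \<in> T"
  have "B \<^bold>\<rightarrow> A \<^bold>\<rightarrow> B \<in> T" "\<^bold>\<not> A \<^bold>\<rightarrow> A \<^bold>\<rightarrow> B \<in> T"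
    using T by (auto intro!: mcs_ILM tautology_in_ILM simp: tautology_def)
  then show "A \<^bold>\<rightarrow> B \<in> T"
    using T imp closed_theory_MP unfolding mcs_def by metis
qed (auto simp: mcs_def intro: closed_theory_MP)

lemmas mcs_simps = mcs_Bot mcs_Imp

text \<open>
  Lets every schematic derivation inside \<open>ILM\<close> be carried out as Boolean reasoning about membership
  in an arbitrary maximal consistent set.
\<close>

lemma not_in_ILM_mcs:
  assumes "A \<notin> ILM"
  obtains T where "mcs T" "A \<notin> T"
proof -
  let ?X = "{B. \<^bold>\<not> A \<^bold>\<rightarrow> B \<in> ILM}"
  have "\<^bold>\<not> \<^bold>\<not> A \<notin> ILM"
  proof
    assume "\<^bold>\<not> \<^bold>\<not> A \<in> ILM"
    moreover have "\<^bold>\<not> \<^bold>\<not> A \<^bold>\<rightarrow> A \<in> ILM"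
      by (rule tautology_in_ILM) (simp add: tautology_def)
    ultimately show False
      using assms closed_theory_MP[OF closed_theory_ILM_self] by blast
  qed
  then obtain M where "mcs M" "?X \<subseteq> M"
    using Lindenbaum[OF closed_theory_adjoin[OF closed_theory_ILM_self]] by blast
  moreover have "\<^bold>\<not> A \<in> ?X"
    by (simp add: tautology_in_ILM tautology_def)
  ultimately show thesis
    using that by (auto simp: mcs_simps)
qed

lemma ILM_Imp_I: "(\<And>T. mcs T \<Longrightarrow> A \<in> T \<Longrightarrow> B \<in> T) \<Longrightarrow> A \<^bold>\<rightarrow> B \<in> ILM"
  by (metis not_in_ILM_mcs mcs_Imp)

lemma ILM_Nec: "A \<in> ILM \<Longrightarrow> \<^bold>\<box> A \<in> ILM"
  by (rule ILM_intros)


section \<open>Modal reasoning inside a maximal consistent set\<close>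

context
  fixes \<Gamma> :: "'p fm set"
  assumes \<Gamma>: "mcs \<Gamma>"
begin

lemma mcs_MP: "A \<^bold>\<rightarrow> B \<in> \<Gamma> \<Longrightarrow> A \<in> \<Gamma> \<Longrightarrow> B \<in> \<Gamma>"
  by (simp add: mcs_Imp[OF \<Gamma>])

lemma mcs_L1: "\<^bold>\<box> (A \<^bold>\<rightarrow> B) \<in> \<Gamma> \<Longrightarrow> \<^bold>\<box> A \<in> \<Gamma> \<Longrightarrow> \<^bold>\<box> B \<in> \<Gamma>"
  by (rule mcs_MP[OF mcs_MP[OF mcs_ILM[OF \<Gamma> ILM_intros(3)]]])

lemma mcs_L2: "\<^bold>\<box> A \<in> \<Gamma> \<Longrightarrow> \<^bold>\<box> \<^bold>\<box> A \<in> \<Gamma>"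
  by (rule mcs_MP[OF mcs_ILM[OF \<Gamma> ILM_intros(4)]])

lemma mcs_L3: "\<^bold>\<box> (\<^bold>\<box> A \<^bold>\<rightarrow> A) \<in> \<Gamma> \<Longrightarrow> \<^bold>\<box> A \<in> \<Gamma>"
  by (rule mcs_MP[OF mcs_ILM[OF \<Gamma> ILM_intros(5)]])

lemma mcs_J1: "\<^bold>\<box> (A \<^bold>\<rightarrow> B) \<in> \<Gamma> \<Longrightarrow> A \<^bold>\<rhd> B \<in> \<Gamma>"
  by (rule mcs_MP[OF mcs_ILM[OF \<Gamma> ILM_intros(6)]])

lemma mcs_J2: "A \<^bold>\<rhd> B \<in> \<Gamma> \<Longrightarrow> B \<^bold>\<rhd> C \<in> \<Gamma> \<Longrightarrow> A \<^bold>\<rhd> C \<in> \<Gamma>"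
  by (rule mcs_MP[OF mcs_ILM[OF \<Gamma> ILM_intros(7)[of A B C]]]) (simp add: mcs_simps[OF \<Gamma>])

lemma mcs_J3: "A \<^bold>\<rhd> C \<in> \<Gamma> \<Longrightarrow> B \<^bold>\<rhd> C \<in> \<Gamma> \<Longrightarrow> A \<^bold>\<or> B \<^bold>\<rhd> C \<in> \<Gamma>"
  by (rule mcs_MP[OF mcs_ILM[OF \<Gamma> ILM_intros(8)]]) (simp add: mcs_simps[OF \<Gamma>])

lemma mcs_J4: "A \<^bold>\<rhd> B \<in> \<Gamma> \<Longrightarrow> \<^bold>\<box> \<^bold>\<not> B \<in> \<Gamma> \<Longrightarrow> \<^bold>\<box> \<^bold>\<not> A \<in> \<Gamma>"
  using mcs_MP[OF mcs_ILM[OF \<Gamma> ILM_intros(9)[of A B]]] by (simp add: mcs_simps[OF \<Gamma>])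

lemma mcs_J5: "\<^bold>\<diamond> A \<^bold>\<rhd> A \<in> \<Gamma>"
  by (rule mcs_ILM[OF \<Gamma> ILM_intros(10)])

lemma mcs_M: "A \<^bold>\<rhd> B \<in> \<Gamma> \<Longrightarrow> A \<^bold>\<and> \<^bold>\<box> C \<^bold>\<rhd> B \<^bold>\<and> \<^bold>\<box> C \<in> \<Gamma>"
  by (rule mcs_MP[OF mcs_ILM[OF \<Gamma> ILM_intros(1)]]) blast+

lemma mcs_Box_mono:
  assumes "\<And>T. mcs T \<Longrightarrow> A \<in> T \<Longrightarrow> B \<in> T" "\<^bold>\<box> A \<in> \<Gamma>"
  shows "\<^bold>\<box> B \<in> \<Gamma>"
proof (rule mcs_L1)
  show "\<^bold>\<box> (A \<^bold>\<rightarrow> B) \<in> \<Gamma>"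
    by (intro mcs_ILM[OF \<Gamma>] ILM_Nec ILM_Imp_I assms(1))
qed fact

lemma mcs_Box_mono2:
  assumes "\<And>T. mcs T \<Longrightarrow> A \<in> T \<Longrightarrow> B \<in> T \<Longrightarrow> C \<in> T" "\<^bold>\<box> A \<in> \<Gamma>" "\<^bold>\<box> B \<in> \<Gamma>"
  shows "\<^bold>\<box> C \<in> \<Gamma>"
proof (rule mcs_L1)
  show "\<^bold>\<box> (B \<^bold>\<rightarrow> C) \<in> \<Gamma>"
    using assms(2) by (rule mcs_Box_mono[rotated]) (simp add: mcs_Imp assms(1))
qed fact

lemma mcs_Rhd_mono:
  assumes "\<And>T. mcs T \<Longrightarrow> A \<in> T \<Longrightarrow> B \<in> T"
  shows "A \<^bold>\<rhd> B \<in> \<Gamma>"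
  by (intro mcs_J1 mcs_ILM[OF \<Gamma>] ILM_Nec ILM_Imp_I assms)

lemma mcs_Rhd_Or_Dia: "A \<^bold>\<or> \<^bold>\<diamond> A \<^bold>\<rhd> A \<in> \<Gamma>"
  by (intro mcs_J3 mcs_J5 mcs_Rhd_mono)

lemma mcs_Rhd_Bot_iff: "A \<^bold>\<rhd> \<^bold>\<bottom> \<in> \<Gamma> \<longleftrightarrow> \<^bold>\<box> \<^bold>\<not> A \<in> \<Gamma>"
proof
  assume "A \<^bold>\<rhd> \<^bold>\<bottom> \<in> \<Gamma>"
  moreover have "\<^bold>\<box> \<^bold>\<not> \<^bold>\<bottom> \<in> \<Gamma>"
    by (intro mcs_ILM[OF \<Gamma>] ILM_Nec tautology_in_ILM) (simp add: tautology_def)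
  ultimately show "\<^bold>\<box> \<^bold>\<not> A \<in> \<Gamma>"
    by (rule mcs_J4)
qed (rule mcs_J1)

lemma mcs_Rhd_of_Box_Neg: "\<^bold>\<box> \<^bold>\<not> A \<in> \<Gamma> \<Longrightarrow> A \<^bold>\<rhd> C \<in> \<Gamma>"
  by (rule mcs_J1) (erule mcs_Box_mono[rotated], simp add: mcs_simps)

lemma mcs_Rhd_of_Box: "\<^bold>\<box> A \<in> \<Gamma> \<Longrightarrow> \<^bold>\<not> A \<^bold>\<rhd> C \<in> \<Gamma>"
  by (rule mcs_Rhd_of_Box_Neg) (erule mcs_Box_mono[rotated], simp add: mcs_simps)

end

text \<open>
  Loeb's axiom in its interpretability form: among the worlds above that satisfy \<open>A\<close> one may always
  pick an \<open>R\<close>-maximal one.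
\<close>

lemma mcs_Rhd_Loeb:
  assumes "mcs \<Gamma>"
  shows "A \<^bold>\<rhd> A \<^bold>\<and> \<^bold>\<box> \<^bold>\<not> A \<in> \<Gamma>"
proof (rule mcs_J2[OF assms mcs_Rhd_mono[OF assms] mcs_Rhd_Or_Dia[OF assms]])
  fix T :: "'a fm set"
  assume T: "mcs T" "A \<in> T"
  have "\<^bold>\<box> \<^bold>\<not> A \<in> T" if "\<^bold>\<box> \<^bold>\<not> (A \<^bold>\<and> \<^bold>\<box> \<^bold>\<not> A) \<in> T"
    by (rule mcs_L3[OF T(1)], rule mcs_Box_mono[OF T(1) _ that]) (auto simp: mcs_simps)
  then show "(A \<^bold>\<and> \<^bold>\<box> \<^bold>\<not> A) \<^bold>\<or> \<^bold>\<diamond> (A \<^bold>\<and> \<^bold>\<box> \<^bold>\<not> A) \<in> T"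
    using T by (auto simp: mcs_simps)
qed


section \<open>Critical successors\<close>

text \<open>
  If the worlds above \<open>x\<close> that \<open>y\<close> reaches by \<open>S\<^sub>x\<close> are all to refute \<open>C\<close>, then no \<open>E\<close> with
  \<open>E \<^bold>\<rhd> C\<close> at \<open>x\<close> may hold at \<open>y\<close> or above it.
\<close>

definition critical :: "'p fm \<Rightarrow> 'p fm set \<Rightarrow> 'p fm set \<Rightarrow> bool" where
  "critical C \<Gamma> \<Delta> \<longleftrightarrow> (\<forall>E. E \<^bold>\<rhd> C \<in> \<Gamma> \<longrightarrow> \<^bold>\<not> E \<in> \<Delta> \<and> \<^bold>\<box> \<^bold>\<not> E \<in> \<Delta>)"

definition Box_subset :: "'p fm set \<Rightarrow> 'p fm set \<Rightarrow> bool" where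
  "Box_subset \<Theta> \<Delta> \<longleftrightarrow> (\<forall>G. \<^bold>\<box> G \<in> \<Theta> \<longrightarrow> \<^bold>\<box> G \<in> \<Delta>)"

lemma Box_subset_refl: "Box_subset \<Gamma> \<Gamma>"
  by (simp add: Box_subset_def)

text \<open>
  A \<open>\<^bold>\<box> A\<close> at \<open>\<Gamma>\<close> gives \<open>\<^bold>\<not> A \<^bold>\<rhd> C\<close> at \<open>\<Gamma>\<close> for every \<open>C\<close>, so criticality subsumes the usual successor
  relation between maximal consistent sets.
\<close>

lemma critical_Box:
  assumes "mcs \<Gamma>" "mcs \<Delta>" "critical C \<Gamma> \<Delta>" "\<^bold>\<box> A \<in> \<Gamma>"
  shows "A \<in> \<Delta>" "\<^bold>\<box> A \<in> \<Delta>"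
proof -
  have *: "\<^bold>\<not> \<^bold>\<not> A \<in> \<Delta>" "\<^bold>\<box> \<^bold>\<not> \<^bold>\<not> A \<in> \<Delta>"
    using assms(3) mcs_Rhd_of_Box[OF assms(1,4)] unfolding critical_def by blast+
  show "A \<in> \<Delta>"
    using * assms by (simp add: mcs_simps)
  show "\<^bold>\<box> A \<in> \<Delta>"
    using *(2) by (rule mcs_Box_mono[OF assms(2), rotated]) (simp add: mcs_simps)
qed

text \<open>
  The set to be extended is \<open>B\<close>, \<open>\<^bold>\<box> \<^bold>\<not> B\<close>, the \<open>\<^bold>\<box> G\<close> from \<open>\<Theta>\<close>, and all \<open>\<^bold>\<not> E\<close>, \<open>\<^bold>\<box> \<^bold>\<not> E\<close> with
  \<open>E \<^bold>\<rhd> C \<in> \<Gamma>\<close>. Were it inconsistent, finitely many of the \<open>G\<close> and \<open>E\<close> would be to blame, and these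
  combine into a single \<open>G\<close> (a conjunction) and a single \<open>E\<close> (a disjunction, by J3). Then
  \<open>B \<^bold>\<and> \<^bold>\<box> G\<close> together with \<open>\<^bold>\<box> \<^bold>\<not> B\<close> implies \<open>E \<^bold>\<or> \<^bold>\<diamond> E\<close>, which interprets \<open>E\<close> and hence \<open>C\<close>; and
  \<open>\<^bold>\<box> \<^bold>\<not> B\<close> comes for free by Loeb's axiom. So \<open>B \<^bold>\<and> \<^bold>\<box> G \<^bold>\<rhd> C\<close> would be in \<open>\<Gamma>\<close>.
\<close>

lemma critical_successor_exists:
  assumes \<Gamma>: "mcs \<Gamma>" and \<Theta>: "mcs \<Theta>"
    and not_Rhd: "\<And>G. \<^bold>\<box> G \<in> \<Theta> \<Longrightarrow> B \<^bold>\<and> \<^bold>\<box> G \<^bold>\<rhd> C \<notin> \<Gamma>"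
  obtains \<Delta> where "mcs \<Delta>" "B \<in> \<Delta>" "\<^bold>\<box> \<^bold>\<not> B \<in> \<Delta>" "critical C \<Gamma> \<Delta>" "Box_subset \<Theta> \<Delta>"
proof -
  (* X is the theory generated by the set to be extended. Its members are described semantically,
     with one pair G, E each: they hold in every maximal consistent set that contains B, [] ~B
     and the formulas contributed by G and E. *)
  define model where "model G E T \<longleftrightarrow> mcs T \<and> B \<in> T \<and> \<^bold>\<box> \<^bold>\<not> B \<in> T \<and>
    \<^bold>\<box> G \<in> T \<and> \<^bold>\<not> E \<in> T \<and> \<^bold>\<box> \<^bold>\<not> E \<in> T" for G E T
  define X where "X = {A. \<exists>G E. \<^bold>\<box> G \<in> \<Theta> \<and> E \<^bold>\<rhd> C \<in> \<Gamma> \<and> (\<forall>T. model G E T \<longrightarrow> A \<in> T)}"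
  have X_I: "A \<in> X" if "\<^bold>\<box> G \<in> \<Theta>" "E \<^bold>\<rhd> C \<in> \<Gamma>" "\<And>T. model G E T \<Longrightarrow> A \<in> T" for A G E
    using that unfolding X_def by blast
  (* Trivial choices of G and E, for members of X that need only one of the two. *)
  have top: "\<^bold>\<box> \<^bold>\<not> \<^bold>\<bottom> \<in> \<Theta>"
    by (intro mcs_ILM[OF \<Theta>] ILM_Nec tautology_in_ILM) (simp add: tautology_def)
  have bot: "\<^bold>\<bottom> \<^bold>\<rhd> C \<in> \<Gamma>"
    by (rule mcs_Rhd_mono[OF \<Gamma>]) (simp add: mcs_simps)
  have "closed_theory X"
    unfolding closed_theory_def
  proof (intro conjI subsetI allI impI)
    fix A :: "'a fm"
    assume "A \<in> ILM"
    then show "A \<in> X"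
      by (intro X_I[OF top bot]) (simp add: model_def mcs_ILM)
  next
    fix A D
    assume "A \<^bold>\<rightarrow> D \<in> X" "A \<in> X"
    then obtain G E G' E' where G: "\<^bold>\<box> G \<in> \<Theta>" "\<^bold>\<box> G' \<in> \<Theta>" and E: "E \<^bold>\<rhd> C \<in> \<Gamma>" "E' \<^bold>\<rhd> C \<in> \<Gamma>"
      and AD: "\<forall>T. model G E T \<longrightarrow> A \<^bold>\<rightarrow> D \<in> T" and A: "\<forall>T. model G' E' T \<longrightarrow> A \<in> T"
      unfolding X_def by blast
    show "D \<in> X"
    proof (rule X_I)
      show "\<^bold>\<box> (G \<^bold>\<and> G') \<in> \<Theta>"
        using G by (rule mcs_Box_mono2[OF \<Theta>, rotated]) (simp add: mcs_simps)
      show "E \<^bold>\<or> E' \<^bold>\<rhd> C \<in> \<Gamma>"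
        using \<Gamma> E by (rule mcs_J3)
      fix T
      assume "model (G \<^bold>\<and> G') (E \<^bold>\<or> E') T"
      then have T: "mcs T" "B \<in> T" "\<^bold>\<box> \<^bold>\<not> B \<in> T" "\<^bold>\<box> (G \<^bold>\<and> G') \<in> T"
        "\<^bold>\<not> (E \<^bold>\<or> E') \<in> T" "\<^bold>\<box> \<^bold>\<not> (E \<^bold>\<or> E') \<in> T"
        by (simp_all add: model_def)
      have "\<^bold>\<box> G \<in> T" "\<^bold>\<box> G' \<in> T"
        using T(4) by (rule mcs_Box_mono[OF T(1), rotated], simp add: mcs_simps)+
      moreover have "\<^bold>\<box> \<^bold>\<not> E \<in> T" "\<^bold>\<box> \<^bold>\<not> E' \<in> T"
        using T(6) by (rule mcs_Box_mono[OF T(1), rotated], simp add: mcs_simps)+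
      ultimately have "model G E T" "model G' E' T"
        using T by (simp_all add: model_def mcs_simps)
      then show "D \<in> T"
        using A AD T(1) mcs_Imp by blast
    qed
  qed
  moreover have "\<^bold>\<bottom> \<notin> X"
  proof
    assume "\<^bold>\<bottom> \<in> X"
    then obtain G E where G: "\<^bold>\<box> G \<in> \<Theta>" and E: "E \<^bold>\<rhd> C \<in> \<Gamma>"
      and no_model: "\<forall>T. model G E T \<longrightarrow> \<^bold>\<bottom> \<in> T"
      unfolding X_def by blast
    (* Loeb's axiom is applied to ?D, not to B, in order to keep [] G. By L2 the worlds above satisfy
       [] G as well, so [] ~?D still yields [] ~B. *)
    let ?D = "B \<^bold>\<and> \<^bold>\<box> G"
    have "?D \<^bold>\<and> \<^bold>\<box> \<^bold>\<not> ?D \<^bold>\<rhd> E \<^bold>\<or> \<^bold>\<diamond> E \<in> \<Gamma>"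
    proof (rule mcs_Rhd_mono[OF \<Gamma>])
      fix T :: "'a fm set"
      assume T: "mcs T" "?D \<^bold>\<and> \<^bold>\<box> \<^bold>\<not> ?D \<in> T"
      then have D: "B \<in> T" "\<^bold>\<box> G \<in> T" "\<^bold>\<box> \<^bold>\<not> ?D \<in> T"
        by (simp_all add: mcs_simps)
      have "\<^bold>\<box> \<^bold>\<not> B \<in> T"
        using D(3) mcs_L2[OF T(1) D(2)]
        by (rule mcs_Box_mono2[OF T(1), rotated]) (simp add: mcs_simps)
      moreover have "\<not> model G E T"
        using no_model T(1) mcs_Bot by blast
      ultimately show "E \<^bold>\<or> \<^bold>\<diamond> E \<in> T"
        using T(1) D by (auto simp: model_def mcs_simps)
    qed
    then have "?D \<^bold>\<and> \<^bold>\<box> \<^bold>\<not> ?D \<^bold>\<rhd> C \<in> \<Gamma>"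
      by (rule mcs_J2[OF \<Gamma> _ mcs_J2[OF \<Gamma> mcs_Rhd_Or_Dia[OF \<Gamma>] E]])
    then have "?D \<^bold>\<rhd> C \<in> \<Gamma>"
      by (rule mcs_J2[OF \<Gamma> mcs_Rhd_Loeb[OF \<Gamma>]])
    then show False
      using not_Rhd[OF G] by contradiction
  qed
  ultimately obtain \<Delta> where \<Delta>: "mcs \<Delta>" "X \<subseteq> \<Delta>"
    by (rule Lindenbaum)
  show thesis
  proof (rule that[OF \<Delta>(1)])
    show "B \<in> \<Delta>" "\<^bold>\<box> \<^bold>\<not> B \<in> \<Delta>"
      by (intro subsetD[OF \<Delta>(2)] X_I[OF top bot]; simp add: model_def)+
    have "\<^bold>\<not> E \<in> \<Delta> \<and> \<^bold>\<box> \<^bold>\<not> E \<in> \<Delta>" if "E \<^bold>\<rhd> C \<in> \<Gamma>" for E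
      by (intro conjI subsetD[OF \<Delta>(2)] X_I[OF top that]; simp add: model_def)
    then show "critical C \<Gamma> \<Delta>"
      by (simp add: critical_def)
    have "\<^bold>\<box> G \<in> \<Delta>" if "\<^bold>\<box> G \<in> \<Theta>" for G
      by (intro subsetD[OF \<Delta>(2)] X_I[OF that bot]; simp add: model_def)
    then show "Box_subset \<Theta> \<Delta>"
      by (simp add: Box_subset_def)
  qed
qed

text \<open>
  Taking \<open>\<Theta> = \<Gamma>\<close> is harmless: what is boxed in \<open>\<Gamma>\<close> may be added to \<open>A\<close> on the left of \<open>\<^bold>\<rhd>\<close>.
\<close>

lemma critical_successor_not_Rhd:
  assumes \<Gamma>: "mcs \<Gamma>" and "A \<^bold>\<rhd> C \<notin> \<Gamma>"
  obtains \<Delta> where "mcs \<Delta>" "A \<in> \<Delta>" "\<^bold>\<box> \<^bold>\<not> A \<in> \<Delta>" "critical C \<Gamma> \<Delta>"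
proof -
  have "A \<^bold>\<and> \<^bold>\<box> G \<^bold>\<rhd> C \<notin> \<Gamma>" if "\<^bold>\<box> G \<in> \<Gamma>" for G
  proof -
    have "A \<^bold>\<rhd> A \<^bold>\<and> \<^bold>\<box> G \<in> \<Gamma>"
      using mcs_L2[OF \<Gamma> that]
      by (intro mcs_J1[OF \<Gamma>]) (erule mcs_Box_mono[OF \<Gamma>, rotated], simp add: mcs_simps)
    then show ?thesis
      using mcs_J2[OF \<Gamma>] assms(2) by blast
  qed
  then show thesis
    using critical_successor_exists[OF \<Gamma> \<Gamma>] that by metis
qed

text \<open>
  The step for which M is the right axiom: it turns \<open>A \<^bold>\<rhd> B\<close> into \<open>A \<^bold>\<and> \<^bold>\<box> G \<^bold>\<rhd> B \<^bold>\<and> \<^bold>\<box> G\<close>, so if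
  \<open>B \<^bold>\<and> \<^bold>\<box> G\<close> interpreted \<open>C\<close>, then \<open>A \<^bold>\<and> \<^bold>\<box> G\<close> would, although it holds at the critical \<open>\<Theta>\<close>.
\<close>

lemma critical_successor_Rhd:
  assumes \<Gamma>: "mcs \<Gamma>" and \<Theta>: "mcs \<Theta>" "critical C \<Gamma> \<Theta>" and "A \<^bold>\<rhd> B \<in> \<Gamma>" "A \<in> \<Theta>"
  obtains \<Delta> where "mcs \<Delta>" "B \<in> \<Delta>" "\<^bold>\<box> \<^bold>\<not> B \<in> \<Delta>" "critical C \<Gamma> \<Delta>" "Box_subset \<Theta> \<Delta>"
proof -
  have "B \<^bold>\<and> \<^bold>\<box> G \<^bold>\<rhd> C \<notin> \<Gamma>" if "\<^bold>\<box> G \<in> \<Theta>" for G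
  proof
    assume "B \<^bold>\<and> \<^bold>\<box> G \<^bold>\<rhd> C \<in> \<Gamma>"
    then have "A \<^bold>\<and> \<^bold>\<box> G \<^bold>\<rhd> C \<in> \<Gamma>"
      using mcs_M[OF \<Gamma> assms(4)] mcs_J2[OF \<Gamma>] by blast
    then have "\<^bold>\<not> (A \<^bold>\<and> \<^bold>\<box> G) \<in> \<Theta>"
      using \<Theta>(2) unfolding critical_def by blast
    then show False
      using that \<Theta>(1) assms(5) by (simp add: mcs_simps)
  qed
  then show thesis
    using critical_successor_exists[OF \<Gamma> \<Theta>(1)] that by metis
qed


section \<open>The tree of worlds\<close>

text \<open>
  A world is its own construction history. \<open>Branch y A C\<close> is the successor of \<open>y\<close> that refutes
  \<open>A \<^bold>\<rhd> C\<close> there; \<open>Switch y v B\<close> is the \<open>S\<^sub>v\<close>-successor of \<open>y\<close> at which \<open>B\<close> holds.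
\<close>

datatype 'p world =
    Root
  | Branch "'p world" "'p fm" "'p fm"
  | Switch "'p world" "'p world" "'p fm"

instance fm :: (countable) countable
  by countable_datatype

instance world :: (countable) countable
  by countable_datatype

primrec ancestor :: "'p world \<Rightarrow> 'p world \<Rightarrow> bool" where
  "ancestor x Root \<longleftrightarrow> x = Root"
| "ancestor x (Branch y A C) \<longleftrightarrow> x = Branch y A C \<or> ancestor x y"
| "ancestor x (Switch y v B) \<longleftrightarrow> x = Switch y v B \<or> ancestor x y"

text \<open>
  The accessibility relation \<open>R\<close>. In the last clause it is \<open>v\<close>, not \<open>y\<close>, that counts as the
  \<open>R\<close>-parent: worlds strictly between \<open>v\<close> and \<open>Switch y v B\<close> need not see the new world.
\<close>

primrec precedes :: "'p world \<Rightarrow> 'p world \<Rightarrow> bool" where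
  "precedes x Root \<longleftrightarrow> False"
| "precedes x (Branch y A C) \<longleftrightarrow> ancestor x y"
| "precedes x (Switch y v B) \<longleftrightarrow> ancestor x v"

text \<open>
  \<open>cone x w\<close> is the formula \<open>C\<close> for which \<open>w\<close> has to be critical over \<open>x\<close>. It is read off the first
  edge on the path from \<open>x\<close> to \<open>w\<close>: a branch at \<open>x\<close> prescribes its \<open>C\<close>. In all other cases it is
  \<open>\<^bold>\<bottom>\<close>, and \<open>\<^bold>\<bottom>\<close>-critical successors are just ordinary successors.
\<close>

primrec cone :: "'p world \<Rightarrow> 'p world \<Rightarrow> 'p fm" where
  "cone x Root = \<^bold>\<bottom>"
| "cone x (Branch y A C) = (if x = y then C else cone x y)"
| "cone x (Switch y v B) = cone x y"

lemma ancestor_refl: "ancestor x x"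
  by (cases x) auto

lemma ancestor_trans: "ancestor x y \<Longrightarrow> ancestor y z \<Longrightarrow> ancestor x z"
  by (induction z) auto

lemma ancestor_size: "ancestor x y \<Longrightarrow> x \<noteq> y \<Longrightarrow> size x < size y"
  by (induction y) fastforce+

lemma ancestor_antisym: "ancestor x y \<Longrightarrow> ancestor y x \<Longrightarrow> x = y"
  using ancestor_size less_asym by metis

lemma cone_eq_Bot: "size w \<le> size x \<Longrightarrow> cone x w = \<^bold>\<bottom>"
  by (induction w) auto

lemma cone_ancestor: "ancestor x v \<Longrightarrow> x \<noteq> v \<Longrightarrow> ancestor v w \<Longrightarrow> cone x w = cone x v"
  by (induction w) (auto dest: ancestor_antisym)

text \<open>
  The finite set \<open>F\<close> limits the formulas for which new worlds are made.
\<close>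

locale critical_tree =
  fixes \<Gamma>\<^sub>0 :: "'p fm set" and F :: "'p fm set"
  assumes mcs_root: "mcs \<Gamma>\<^sub>0" and finite_F: "finite F"
begin

primrec lab :: "'p world \<Rightarrow> 'p fm set" where
  "lab Root = \<Gamma>\<^sub>0"
| "lab (Branch y A C) =
    (SOME \<Delta>. mcs \<Delta> \<and> A \<in> \<Delta> \<and> \<^bold>\<box> \<^bold>\<not> A \<in> \<Delta> \<and> critical C (lab y) \<Delta>)"
| "lab (Switch y v B) =
    (SOME \<Delta>. mcs \<Delta> \<and> B \<in> \<Delta> \<and> \<^bold>\<box> \<^bold>\<not> B \<in> \<Delta> \<and> critical (cone v y) (lab v) \<Delta> \<and>
      Box_subset (lab y) \<Delta>)"

declare lab.simps(2,3)[simp del]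

inductive_set W :: "'p world set" where
  Root: "Root \<in> W"
| Branch: "y \<in> W \<Longrightarrow> A \<in> F \<Longrightarrow> A \<^bold>\<rhd> C \<notin> lab y \<Longrightarrow> Branch y A C \<in> W"
| Switch: "y \<in> W \<Longrightarrow> precedes v y \<Longrightarrow> B \<in> F \<Longrightarrow> A \<^bold>\<rhd> B \<in> lab v \<Longrightarrow> A \<in> lab y \<Longrightarrow>
    Switch y v B \<in> W"

definition new_box :: "'p fm set \<Rightarrow> 'p fm set \<Rightarrow> bool" where
  "new_box \<Gamma> \<Delta> \<longleftrightarrow> (\<exists>A\<in>F. \<^bold>\<box> \<^bold>\<not> A \<notin> \<Gamma> \<and> \<^bold>\<box> \<^bold>\<not> A \<in> \<Delta>)"

text \<open>
  The invariant of the construction. An ancestor \<open>x\<close> of \<open>w\<close> need not \<open>R\<close>-precede it, so \<open>\<^bold>\<not> E\<close> cannot be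
  required at \<open>w\<close> itself. The weaker demand on \<open>\<^bold>\<box> \<^bold>\<not> E\<close> does hold for all ancestors, because boxes are
  inherited along both kinds of edges, and it gives back full criticality at the next \<open>R\<close>-step.
\<close>

definition good_ancestor :: "'p world \<Rightarrow> 'p world \<Rightarrow> bool" where
  "good_ancestor x w \<longleftrightarrow> x \<in> W \<and> mcs (lab x) \<and> Box_subset (lab x) (lab w) \<and>
     (\<forall>E. E \<^bold>\<rhd> cone x w \<in> lab x \<longrightarrow> \<^bold>\<box> \<^bold>\<not> E \<in> lab w)"

definition good_predecessor :: "'p world \<Rightarrow> 'p world \<Rightarrow> bool" where
  "good_predecessor x w \<longleftrightarrow> ancestor x w \<and> new_box (lab x) (lab w) \<and>
     critical (cone x w) (lab x) (lab w)"

definition good :: "'p world \<Rightarrow> bool" where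
  "good w \<longleftrightarrow> (\<forall>x. ancestor x w \<longrightarrow> good_ancestor x w) \<and>
     (\<forall>x. precedes x w \<longrightarrow> good_predecessor x w)"

lemma good_ancestor_refl: "w \<in> W \<Longrightarrow> mcs (lab w) \<Longrightarrow> good_ancestor w w"
  unfolding good_ancestor_def by (simp add: Box_subset_refl cone_eq_Bot mcs_Rhd_Bot_iff)

lemma goodD:
  assumes "good w"
  shows "ancestor x w \<Longrightarrow> good_ancestor x w" "precedes x w \<Longrightarrow> good_predecessor x w" "mcs (lab w)"
  using assms ancestor_refl[of w] unfolding good_def good_ancestor_def by blast+

lemma lab_Branch:
  assumes "mcs (lab y)" "A \<^bold>\<rhd> C \<notin> lab y"
  shows "mcs (lab (Branch y A C))" "A \<in> lab (Branch y A C)" "\<^bold>\<box> \<^bold>\<not> A \<in> lab (Branch y A C)"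
    "critical C (lab y) (lab (Branch y A C))"
proof -
  let ?P = "\<lambda>\<Delta>. mcs \<Delta> \<and> A \<in> \<Delta> \<and> \<^bold>\<box> \<^bold>\<not> A \<in> \<Delta> \<and> critical C (lab y) \<Delta>"
  have "\<exists>\<Delta>. ?P \<Delta>"
    using critical_successor_not_Rhd[OF assms] by metis
  then have "?P (lab (Branch y A C))"
    unfolding lab.simps by (rule someI_ex)
  then show "mcs (lab (Branch y A C))" "A \<in> lab (Branch y A C)" "\<^bold>\<box> \<^bold>\<not> A \<in> lab (Branch y A C)"
    "critical C (lab y) (lab (Branch y A C))"
    by blast+
qed

lemma lab_Switch:
  assumes "mcs (lab v)" "mcs (lab y)" "critical (cone v y) (lab v) (lab y)" "A \<^bold>\<rhd> B \<in> lab v"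
    "A \<in> lab y"
  shows "mcs (lab (Switch y v B))" "B \<in> lab (Switch y v B)" "\<^bold>\<box> \<^bold>\<not> B \<in> lab (Switch y v B)"
    "critical (cone v y) (lab v) (lab (Switch y v B))" "Box_subset (lab y) (lab (Switch y v B))"
proof -
  let ?P = "\<lambda>\<Delta>. mcs \<Delta> \<and> B \<in> \<Delta> \<and> \<^bold>\<box> \<^bold>\<not> B \<in> \<Delta> \<and> critical (cone v y) (lab v) \<Delta> \<and>
    Box_subset (lab y) \<Delta>"
  have "\<exists>\<Delta>. ?P \<Delta>"
    using critical_successor_Rhd[OF assms] by metis
  then have "?P (lab (Switch y v B))"
    unfolding lab.simps by (rule someI_ex)
  then show "mcs (lab (Switch y v B))" "B \<in> lab (Switch y v B)" "\<^bold>\<box> \<^bold>\<not> B \<in> lab (Switch y v B)"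
    "critical (cone v y) (lab v) (lab (Switch y v B))" "Box_subset (lab y) (lab (Switch y v B))"
    by blast+
qed

lemma new_box_mono: "Box_subset \<Gamma> \<Delta> \<Longrightarrow> new_box \<Delta> \<Theta> \<Longrightarrow> new_box \<Gamma> \<Theta>"
  unfolding new_box_def Box_subset_def by blast

text \<open>
  A new box \<open>\<^bold>\<box> \<^bold>\<not> A\<close> appears because \<open>A \<^bold>\<rhd> C \<notin> lab y\<close> rules out \<open>\<^bold>\<box> \<^bold>\<not> A \<in> lab y\<close>. Criticality over \<open>y\<close>
  holds by choice of the label; over older ancestors it comes from their boxes in \<open>lab y\<close>.
\<close>

lemma good_Branch:
  assumes y: "y \<in> W" "good y" and A: "A \<in> F" "A \<^bold>\<rhd> C \<notin> lab y"
  shows "good (Branch y A C)"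
proof -
  let ?w = "Branch y A C"
  note w = lab_Branch[OF goodD(3)[OF y(2)] A(2)]
  have "?w \<in> W"
    using y(1) A by (rule W.Branch)
  have box: "G \<in> lab ?w \<and> \<^bold>\<box> G \<in> lab ?w" if "\<^bold>\<box> G \<in> lab y" for G
    using critical_Box[OF goodD(3)[OF y(2)] w(1,4) that] by blast
  have new: "new_box (lab y) (lab ?w)"
    using A w(3) mcs_Rhd_of_Box_Neg[OF goodD(3)[OF y(2)]] unfolding new_box_def by blast
  have *: "good_ancestor x ?w \<and> good_predecessor x ?w" if x: "ancestor x y" for x
  proof -
    have xy: "good_ancestor x y"
      using y(2) x by (rule goodD)
    have "critical (cone x ?w) (lab x) (lab ?w)"
    proof (cases "x = y")
      case True
      then show ?thesis
        using w(4) by simp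
    next
      case False
      then show ?thesis
        using xy box unfolding critical_def good_ancestor_def by simp
    qed
    moreover have "Box_subset (lab x) (lab ?w)"
      using xy box unfolding good_ancestor_def Box_subset_def by blast
    moreover have "new_box (lab x) (lab ?w)"
      using xy new unfolding good_ancestor_def by (blast intro: new_box_mono)
    ultimately show ?thesis
      using xy x unfolding good_ancestor_def good_predecessor_def critical_def by simp
  qed
  then show ?thesis
    using good_ancestor_refl[OF \<open>?w \<in> W\<close> w(1)] unfolding good_def by auto
qed

text \<open>
  The new box is \<open>\<^bold>\<box> \<^bold>\<not> B\<close>: it is absent from \<open>lab v\<close>, since by J4 it would bring \<open>\<^bold>\<box> \<^bold>\<not> A\<close> into \<open>lab v\<close>,
  contradicting \<open>A \<in> lab y\<close>. It may already be present in \<open>lab y\<close>, which is no obstacle as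
  \<open>y\<close> does not \<open>R\<close>-precede the new world.
\<close>

lemma good_Switch:
  assumes y: "y \<in> W" "good y" and v: "precedes v y" "good v"
    and A: "B \<in> F" "A \<^bold>\<rhd> B \<in> lab v" "A \<in> lab y"
  shows "good (Switch y v B)"
proof -
  let ?w = "Switch y v B"
  note mcs_v = goodD(3)[OF v(2)]
  have vy: "ancestor v y" "critical (cone v y) (lab v) (lab y)"
    using goodD(2)[OF y(2) v(1)] by (auto simp: good_predecessor_def)
  note w = lab_Switch[OF mcs_v goodD(3)[OF y(2)] vy(2) A(2,3)]
  have "?w \<in> W"
    using y(1) v(1) A by (rule W.Switch)
  have "\<^bold>\<box> \<^bold>\<not> B \<notin> lab v"
  proof
    assume "\<^bold>\<box> \<^bold>\<not> B \<in> lab v"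
    then have "\<^bold>\<box> \<^bold>\<not> A \<in> lab v"
      by (rule mcs_J4[OF mcs_v A(2)])
    then have "\<^bold>\<not> A \<in> lab y"
      by (rule critical_Box(1)[OF mcs_v goodD(3)[OF y(2)] vy(2)])
    then show False
      using A(3) goodD(3)[OF y(2)] by (simp add: mcs_simps)
  qed
  then have new: "new_box (lab v) (lab ?w)"
    using A(1) w(3) unfolding new_box_def by blast
  have anc: "good_ancestor x ?w" if x: "ancestor x y" for x
    using goodD(1)[OF y(2) x] w(5) unfolding good_ancestor_def Box_subset_def by simp
  have pred: "good_predecessor x ?w" if x: "ancestor x v" for x
  proof -
    have xv: "good_ancestor x v"
      using v(2) x by (rule goodD)
    have "critical (cone x ?w) (lab x) (lab ?w)"
    proof (cases "x = v")
      case True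
      then show ?thesis
        using w(4) by simp
    next
      case False
      then have "cone x ?w = cone x v"
        using cone_ancestor[OF x _ vy(1)] by simp
      then show ?thesis
        using xv critical_Box[OF mcs_v w(1,4)] unfolding critical_def good_ancestor_def by simp
    qed
    then show ?thesis
      using xv new ancestor_trans[OF x vy(1)]
      unfolding good_predecessor_def good_ancestor_def by (auto intro: new_box_mono)
  qed
  show ?thesis
    using anc pred good_ancestor_refl[OF \<open>?w \<in> W\<close> w(1)] unfolding good_def by auto
qed

text \<open>
  Stated for all ancestors of \<open>w\<close>, since a switch at \<open>y\<close> relies on the invariant at the earlier world
  \<open>v\<close> and not only at its immediate predecessor \<open>y\<close>.
\<close>

lemma ancestors_good: "w \<in> W \<Longrightarrow> ancestor x w \<Longrightarrow> good x"
proof (induction arbitrary: x rule: W.induct)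
  case Root
  then show ?case
    using good_ancestor_refl[OF W.Root] mcs_root by (simp add: good_def)
next
  case (Branch y A C)
  moreover have "good y"
    using Branch.IH ancestor_refl by blast
  ultimately show ?case
    using good_Branch by auto
next
  case (Switch y v B A)
  moreover have "good y"
    using Switch.IH ancestor_refl by blast
  moreover have "good v"
    using Switch.IH goodD(2)[OF \<open>good y\<close> Switch.hyps(2)] by (simp add: good_predecessor_def)
  ultimately show ?case
    using good_Switch by auto
qed

lemma W_good: "w \<in> W \<Longrightarrow> good w"
  by (erule ancestors_good) (rule ancestor_refl)

lemma W_mcs: "w \<in> W \<Longrightarrow> mcs (lab w)"
  by (intro goodD W_good)

lemma precedes_imp_ancestor: "w \<in> W \<Longrightarrow> precedes x w \<Longrightarrow> ancestor x w"
  using goodD(2) W_good good_predecessor_def by blast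

lemma precedes_critical: "w \<in> W \<Longrightarrow> precedes x w \<Longrightarrow> critical (cone x w) (lab x) (lab w)"
  using goodD(2) W_good good_predecessor_def by blast

lemma ancestor_in_W: "w \<in> W \<Longrightarrow> ancestor x w \<Longrightarrow> x \<in> W"
  using goodD(1) W_good good_ancestor_def by blast

lemma ancestor_precedes: "ancestor x y \<Longrightarrow> precedes y z \<Longrightarrow> precedes x z"
  by (cases z) (auto intro: ancestor_trans)


section \<open>The canonical model\<close>

definition R :: "'p world rel" where
  "R = {(x, y). x \<in> W \<and> y \<in> W \<and> precedes x y}"

definition S :: "'p world \<Rightarrow> 'p world rel" where
  "S x = {(y, z). (x, y) \<in> R \<and> (x, z) \<in> R \<and> ancestor y z}"

definition V :: "('p world \<times> 'p) set" where
  "V = {(w, p). w \<in> W \<and> Var p \<in> lab w}"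

lemma R_I: "y \<in> W \<Longrightarrow> precedes x y \<Longrightarrow> (x, y) \<in> R"
  by (simp add: R_def ancestor_in_W[OF _ precedes_imp_ancestor])

lemma R_increases_boxes:
  assumes "(x, y) \<in> R"
  shows "card {A \<in> F. \<^bold>\<box> \<^bold>\<not> A \<in> lab x} < card {A \<in> F. \<^bold>\<box> \<^bold>\<not> A \<in> lab y}"
proof (rule psubset_card_mono)
  have "y \<in> W" "precedes x y"
    using assms by (simp_all add: R_def)
  then have "good_predecessor x y" "good_ancestor x y"
    by (simp_all add: goodD W_good precedes_imp_ancestor)
  then show "{A \<in> F. \<^bold>\<box> \<^bold>\<not> A \<in> lab x} \<subset> {A \<in> F. \<^bold>\<box> \<^bold>\<not> A \<in> lab y}"
    unfolding good_predecessor_def good_ancestor_def new_box_def Box_subset_def by blast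
qed (simp add: finite_F)

lemma R_maximal:
  assumes "X \<noteq> {}"
  shows "\<exists>m\<in>X. \<forall>y\<in>X. (m, y) \<notin> R"
proof -
  let ?f = "\<lambda>w. card {A \<in> F. \<^bold>\<box> \<^bold>\<not> A \<in> lab w}"
  obtain k where "k \<in> X"
    using assms by blast
  moreover have "\<forall>y. y \<in> X \<longrightarrow> ?f y < Suc (card F)"
    by (simp add: less_Suc_eq_le card_mono finite_F)
  ultimately have "\<exists>m. m \<in> X \<and> (\<forall>y. y \<in> X \<longrightarrow> ?f y \<le> ?f m)"
    by (rule Lattices_Big.ex_has_greatest_nat[of "\<lambda>y. y \<in> X"])
  then obtain m where m: "m \<in> X" "\<forall>y. y \<in> X \<longrightarrow> ?f y \<le> ?f m"
    by (elim exE conjE)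
  have "(m, y) \<notin> R" if "y \<in> X" for y
    using R_increases_boxes[of m y] m(2) that by fastforce
  then show ?thesis
    using m(1) by blast
qed

text \<open>
  If \<open>A \<^bold>\<rhd> B\<close> is in \<open>lab x\<close>, a switch at \<open>y\<close> over \<open>x\<close> is the required witness. If it is not, the branch
  \<open>Branch x A B\<close> refutes it: everything \<open>S\<^sub>x\<close>-reachable from there is \<open>B\<close>-critical over \<open>x\<close>, and since
  \<open>B \<^bold>\<rhd> B\<close> is in \<open>lab x\<close>, such worlds contain \<open>\<^bold>\<not> B\<close>.
\<close>

lemma truth_Rhd:
  assumes F: "A \<in> F" "B \<in> F" and x: "x \<in> W"
  shows "A \<^bold>\<rhd> B \<in> lab x \<longleftrightarrow>
    (\<forall>y. (x, y) \<in> R \<and> A \<in> lab y \<longrightarrow> (\<exists>z. (y, z) \<in> S x \<and> B \<in> lab z))"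
proof (intro iffI allI impI)
  fix y
  assume AB: "A \<^bold>\<rhd> B \<in> lab x" and "(x, y) \<in> R \<and> A \<in> lab y"
  then have y: "y \<in> W" "precedes x y" "A \<in> lab y" "(x, y) \<in> R"
    by (auto simp: R_def)
  have "Switch y x B \<in> W"
    using y F AB by (blast intro: W.Switch)
  then have "(x, Switch y x B) \<in> R"
    by (rule R_I) (simp add: ancestor_refl)
  moreover have "B \<in> lab (Switch y x B)"
    by (rule lab_Switch(2)[OF W_mcs[OF x] W_mcs[OF y(1)] precedes_critical[OF y(1,2)] AB y(3)])
  ultimately show "\<exists>z. (y, z) \<in> S x \<and> B \<in> lab z"
    using y(4) by (intro exI[of _ "Switch y x B"]) (simp add: S_def ancestor_refl)
next
  assume *: "\<forall>y. (x, y) \<in> R \<and> A \<in> lab y \<longrightarrow> (\<exists>z. (y, z) \<in> S x \<and> B \<in> lab z)"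
  show "A \<^bold>\<rhd> B \<in> lab x"
  proof (rule ccontr)
    assume AB: "A \<^bold>\<rhd> B \<notin> lab x"
    let ?y = "Branch x A B"
    have "(x, ?y) \<in> R"
      using x F(1) AB by (auto intro!: R_I W.Branch ancestor_refl)
    moreover have "A \<in> lab ?y"
      by (rule lab_Branch(2)[OF W_mcs[OF x] AB])
    ultimately obtain z where z: "(?y, z) \<in> S x" "B \<in> lab z"
      using * by blast
    then have z': "z \<in> W" "precedes x z" "ancestor ?y z"
      by (auto simp: S_def R_def)
    have "cone x z = cone x ?y"
      using z'(3) by (intro cone_ancestor) (auto simp: ancestor_refl dest: arg_cong[of _ _ size])
    then have "critical B (lab x) (lab z)"
      using precedes_critical[OF z'(1,2)] by simp
    moreover have "B \<^bold>\<rhd> B \<in> lab x"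
      by (rule mcs_Rhd_mono[OF W_mcs[OF x]])
    ultimately have "\<^bold>\<not> B \<in> lab z"
      by (simp add: critical_def)
    then show False
      using z(2) W_mcs[OF z'(1)] by (simp add: mcs_simps)
  qed
qed

text \<open>
  A missing \<open>\<^bold>\<box> A\<close> is treated as a missing \<open>\<^bold>\<not> A \<^bold>\<rhd> \<^bold>\<bottom>\<close>.
\<close>

lemma truth_Box:
  assumes F: "\<^bold>\<not> A \<in> F" and x: "x \<in> W"
  shows "\<^bold>\<box> A \<in> lab x \<longleftrightarrow> (\<forall>y. (x, y) \<in> R \<longrightarrow> A \<in> lab y)"
proof (intro iffI allI impI)
  fix y
  assume A: "\<^bold>\<box> A \<in> lab x" and "(x, y) \<in> R"
  then have y: "y \<in> W" "precedes x y"
    by (simp_all add: R_def)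
  show "A \<in> lab y"
    by (rule critical_Box(1)[OF W_mcs[OF x] W_mcs[OF y(1)] precedes_critical[OF y] A])
next
  assume *: "\<forall>y. (x, y) \<in> R \<longrightarrow> A \<in> lab y"
  show "\<^bold>\<box> A \<in> lab x"
  proof (rule ccontr)
    assume "\<^bold>\<box> A \<notin> lab x"
    then have "\<^bold>\<box> \<^bold>\<not> \<^bold>\<not> A \<notin> lab x"
      using mcs_Box_mono[OF W_mcs[OF x], of "\<^bold>\<not> \<^bold>\<not> A" A] by (auto simp: mcs_simps)
    then have A: "\<^bold>\<not> A \<^bold>\<rhd> \<^bold>\<bottom> \<notin> lab x"
      using mcs_Rhd_Bot_iff[OF W_mcs[OF x]] by blast
    let ?y = "Branch x (\<^bold>\<not> A) \<^bold>\<bottom>"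
    have y: "?y \<in> W"
      using x F A by (rule W.Branch)
    have "A \<in> lab ?y"
      using * R_I[OF y] by (simp add: ancestor_refl)
    then show False
      using lab_Branch(2)[OF W_mcs[OF x] A] W_mcs[OF y] by (simp add: mcs_simps)
  qed
qed

end

text \<open>
  The formulas for which the evaluation of a given formula may require a new world.
\<close>

primrec goals :: "'p fm \<Rightarrow> 'p fm set" where
  "goals \<^bold>\<bottom> = {}"
| "goals (Var p) = {}"
| "goals (A \<^bold>\<rightarrow> B) = goals A \<union> goals B"
| "goals (\<^bold>\<box> A) = insert (\<^bold>\<not> A) (goals A)"
| "goals (A \<^bold>\<rhd> B) = {A, B} \<union> goals A \<union> goals B"

lemma finite_goals: "finite (goals A)"
  by (induction A) auto

lemma (in critical_tree) truth_lemma: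
  "goals A \<subseteq> F \<Longrightarrow> w \<in> W \<Longrightarrow> forces R S V w A \<longleftrightarrow> A \<in> lab w"
proof (induction A arbitrary: w)
  case Bot
  then show ?case
    using W_mcs mcs_Bot by auto
next
  case (Var p)
  then show ?case
    by (simp add: V_def)
next
  case (Imp A B)
  then show ?case
    using W_mcs[of w] by (simp add: mcs_Imp)
next
  case (Box A)
  have "forces R S V v A \<longleftrightarrow> A \<in> lab v" if "(w, v) \<in> R" for v
    using Box.IH Box.prems that by (simp add: R_def)
  then show ?case
    using truth_Box[of A w] Box.prems by auto
next
  case (Rhd A B)
  have "forces R S V v A \<longleftrightarrow> A \<in> lab v" "forces R S V v B \<longleftrightarrow> B \<in> lab v" if "(w, v) \<in> R" for v
    using Rhd.IH Rhd.prems that by (simp_all add: R_def)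
  moreover have "(w, v) \<in> R" if "(u, v) \<in> S w" for u v
    using that by (simp add: S_def)
  ultimately show ?case
    using truth_Rhd[of A B w] Rhd.prems by (simp cong: conj_cong)
qed

lemma critical_tree_ILM_frame:
  fixes \<Gamma> :: "'p::countable fm set"
  assumes "critical_tree \<Gamma> F"
  shows "ILM_frame (critical_tree.W \<Gamma> F) (critical_tree.R \<Gamma> F) (critical_tree.S \<Gamma> F)"
proof -
  interpret critical_tree \<Gamma> F
    by fact
  show ?thesis
  proof
    show "W \<noteq> {}"
      using W.Root by blast
    show "countable W"
      by (rule countableI_type)
    show "R \<subseteq> W \<times> W"
      by (auto simp: R_def)
    show "S x \<subseteq> W \<times> W" for x
      by (auto simp: S_def R_def)
    show "\<exists>m\<in>X. \<forall>y\<in>X. (m, y) \<notin> R" if "X \<noteq> {}" for X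
      using that by (rule R_maximal)
    show "(x, z) \<in> R" if "(x, y) \<in> R" "(y, z) \<in> R" for x y z
      using that ancestor_precedes precedes_imp_ancestor unfolding R_def by blast
    then show "(y, z) \<in> S x" if "(x, y) \<in> R" "(y, z) \<in> R" for x y z
      using that precedes_imp_ancestor unfolding S_def R_def by blast
    show "(x, y) \<in> R \<and> (x, z) \<in> R" if "(y, z) \<in> S x" for x y z
      using that by (simp add: S_def)
    show "(y, y) \<in> S x" if "(x, y) \<in> R" for x y
      using that ancestor_refl by (simp add: S_def)
    show "(u, w) \<in> S x" if "(u, v) \<in> S x" "(v, w) \<in> S x" for x u v w
      using that ancestor_trans unfolding S_def by blast
    show "(y, u) \<in> R" if "(y, z) \<in> S x" "(z, u) \<in> R" for x y z u
      using that ancestor_precedes unfolding S_def R_def by blast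
  qed
qed


section \<open>Renaming worlds\<close>

lemma ILM_frame_rename:
  assumes g: "bij_betw g W' W" and "ILM_frame W R S"
  defines "rename \<equiv> \<lambda>Q. {(m, n). m \<in> W' \<and> n \<in> W' \<and> (g m, g n) \<in> Q}"
  shows "ILM_frame W' (rename R) (\<lambda>m. rename (S (g m)))"
proof -
  interpret ILM_frame W R S
    by fact
  have in_W: "g m \<in> W" if "m \<in> W'" for m
    using g that by (auto simp: bij_betw_def)
  show ?thesis
  proof
    show "W' \<noteq> {}"
      using g nonempty by (auto simp: bij_betw_def)
    show "countable W'"
      using g countable countable_image_inj_on by (auto simp: bij_betw_def)
    show "\<exists>m\<in>X. \<forall>y\<in>X. (m, y) \<notin> rename R" if X: "X \<subseteq> W'" "X \<noteq> {}" for X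
    proof -
      have "\<exists>m\<in>g ` X. \<forall>y\<in>g ` X. (m, y) \<notin> R"
        using X in_W by (intro conv_wf) auto
      then show ?thesis
        by (auto simp: rename_def)
    qed
    show "(x, z) \<in> rename R" if "(x, y) \<in> rename R" "(y, z) \<in> rename R" for x y z
      using that R_trans unfolding rename_def by blast
    show "(x, y) \<in> rename R \<and> (x, z) \<in> rename R"
      if "x \<in> W'" "(y, z) \<in> rename (S (g x))" for x y z
      using that S_above in_W unfolding rename_def by blast
    show "(y, y) \<in> rename (S (g x))" if "(x, y) \<in> rename R" for x y
      using that S_refl unfolding rename_def by blast
    show "(y, z) \<in> rename (S (g x))" if "(x, y) \<in> rename R" "(y, z) \<in> rename R" for x y z
      using that R_in_S unfolding rename_def by blast
    show "(u, w) \<in> rename (S (g x))"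
      if "x \<in> W'" "(u, v) \<in> rename (S (g x))" "(v, w) \<in> rename (S (g x))" for x u v w
      using that S_trans in_W unfolding rename_def by blast
    show "(y, u) \<in> rename R" if "x \<in> W'" "(y, z) \<in> rename (S (g x))" "(z, u) \<in> rename R"
      for x y z u
      using that M_cond in_W unfolding rename_def by blast
  qed (auto simp: rename_def)
qed

lemma forces_rename:
  assumes g: "bij_betw g W' W" and R: "R \<subseteq> W \<times> W" and S: "\<And>x. x \<in> W \<Longrightarrow> S x \<subseteq> W \<times> W"
  defines "rename \<equiv> \<lambda>Q. {(m, n). m \<in> W' \<and> n \<in> W' \<and> (g m, g n) \<in> Q}"
  shows "m \<in> W' \<Longrightarrow> forces (rename R) (\<lambda>m. rename (S (g m))) {(m, p). m \<in> W' \<and> (g m, p) \<in> V} m A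
    \<longleftrightarrow> forces R S V (g m) A"
proof (induction A arbitrary: m)
  have rename_iff: "(m, n) \<in> rename Q \<longleftrightarrow> m \<in> W' \<and> n \<in> W' \<and> (g m, g n) \<in> Q" for m n Q
    by (simp add: rename_def)
  have all_R: "(\<forall>u. (g m, u) \<in> R \<longrightarrow> P u) \<longleftrightarrow> (\<forall>n. n \<in> W' \<longrightarrow> (g m, g n) \<in> R \<longrightarrow> P (g n))" for m P
  proof -
    have "u \<in> g ` W'" if "(g m, u) \<in> R" for u
      using that g R by (auto simp: bij_betw_def)
    then show ?thesis
      by blast
  qed
  {
    case (Box A)
    then show ?case
      by (simp add: all_R rename_iff imp_conjL)
  next
    case (Rhd A B)
    have "v \<in> g ` W'" if "(u, v) \<in> S (g m)" for u v
      using that g S[of "g m"] Rhd.prems by (auto simp: bij_betw_def)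
    then have ex_S: "(\<exists>v. (u, v) \<in> S (g m) \<and> P v) \<longleftrightarrow> (\<exists>k. k \<in> W' \<and> (u, g k) \<in> S (g m) \<and> P (g k))"
      for u P
      by blast
    show ?case
      using Rhd by (simp add: all_R ex_S rename_iff imp_conjL conj_assoc cong: conj_cong)
  }
qed auto

theorem theorem3p9:
  fixes \<phi> :: "'p::countable fm"
  assumes "\<And>(W :: nat set) R S V w.
    IL_model W R S V \<Longrightarrow> ILM_frame W R S \<Longrightarrow> w \<in> W \<Longrightarrow> forces R S V w \<phi>"
  shows "\<phi> \<in> ILM"
proof (rule ccontr)
  assume "\<phi> \<notin> ILM"
  then obtain \<Gamma> where \<Gamma>: "mcs \<Gamma>" "\<phi> \<notin> \<Gamma>"
    by (rule not_in_ILM_mcs)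
  then interpret critical_tree \<Gamma> "goals \<phi>"
    by unfold_locales (auto simp: finite_goals)
  interpret ILM_frame W R S
    by (rule critical_tree_ILM_frame) unfold_locales
  let ?W = "to_nat_on W ` W" and ?g = "from_nat_into W"
  let ?rename = "\<lambda>Q. {(m, n). m \<in> ?W \<and> n \<in> ?W \<and> (?g m, ?g n) \<in> Q}"
  let ?R = "?rename R" and ?S = "\<lambda>m. ?rename (S (?g m))"
    and ?V = "{(m, p). m \<in> ?W \<and> (?g m, p) \<in> V}"
  have g: "bij_betw ?g ?W W"
    by (rule bij_betw_byWitness[where f' = "to_nat_on W"]) (auto simp: countable)
  have frame: "ILM_frame ?W ?R ?S"
    by (rule ILM_frame_rename[OF g ILM_frame_axioms])
  have "IL_model ?W ?R ?S ?V"
    by (intro IL_model.intro IL_model_axioms.intro ILM_frame.axioms(1)[OF frame]) auto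
  then have "forces ?R ?S ?V (to_nat_on W Root) \<phi>"
    by (rule assms[OF _ frame]) (simp add: W.Root)
  then have "forces R S V Root \<phi>"
    using forces_rename[where S = S and V = V, OF g R_on S_on, of "to_nat_on W Root" \<phi>]
      countable W.Root by simp
  then show False
    using truth_lemma[OF subset_refl W.Root] \<Gamma>(2) by simp
qed

end
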